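(* For every integer $n\ge 1$, $$\sum_{k=0}^{n}\boldsymbol{l}(n,k)-\frac{1}{2}\sum_{k=0}^{n-1}\boldsymbol{l}(n-1,k)=\frac{(-1)^{n}}{n!}D_{n}.$$
   Context: The Leibnitz numbers are defined for integers $n\ge 0$ and $0\le k\le n$ by $\boldsymbol{l}(n,k)=\dfrac{1}{(n+1)\binom{n}{k}}$. The Daehee numbers $D_n$ ($n\ge 0$) are defined by $\dfrac{\log(1+u)}{u}=\sum_{n=0}^{\infty}D_n\dfrac{u^n}{n!}$; explicitly $D_n=(-1)^n\dfrac{n!}{n+1}$. *)

theory Defs
  imports "HOL-Analysis.Analysis" "HOL-Computational_Algebra.Formal_Power_Series"
begin

text \<open>Only the range \<open>k \<le> n\<close> is meaningful; outside it the value is \<open>1 / 0 = 0\<close>.\<close>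

definition leibnitz :: "nat \<Rightarrow> nat \<Rightarrow> real" where
  "leibnitz n k = 1 / ((real n + 1) * real (n choose k))"

text \<open>
  The Daehee numbers are given by the exponential generating function \<open>log (1 + u) / u\<close>.
  The library's \<open>fps_ln 1\<close> is the power series of \<open>log (1 + u)\<close>, and division by
  \<open>fps_X\<close> is exact because its constant term vanishes.
\<close>

definition daehee :: "nat \<Rightarrow> real" where
  "daehee n = fact n * fps_nth (fps_ln 1 / fps_X) n"

lemma daehee_egf: "Abs_fps (\<lambda>n. daehee n / fact n) = fps_ln 1 / fps_X"
  by (simp add: daehee_def fps_eq_iff)

lemma daehee_explicit: "daehee n = (-1) ^ n * (fact n / (real n + 1))"
  by (simp add: daehee_def fps_ln_nth add.commute)

lemma daehee_sums:
  fixes u :: real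
  assumes "\<bar>u\<bar> < 1" "u \<noteq> 0"
  shows "(\<lambda>n. daehee n * (u ^ n / fact n)) sums (ln (1 + u) / u)"
proof -
  have "(\<lambda>n. - ((-u) ^ n) / of_nat n) sums ln (1 + u)"
    using assms(1) by (rule ln_series')
  then have "(\<lambda>n. - ((-u) ^ Suc n) / of_nat (Suc n)) sums ln (1 + u)"
    by (subst sums_Suc_iff) simp
  then have "(\<lambda>n. - ((-u) ^ Suc n) / of_nat (Suc n) / u) sums (ln (1 + u) / u)"
    by (rule sums_divide)
  moreover have "- ((-u) ^ Suc n) / of_nat (Suc n) / u = daehee n * (u ^ n / fact n)" for n
    using assms(2) power_minus[of u n]
    by (simp add: daehee_explicit add.commute)
  ultimately show ?thesis
    by simp
qed

end

theory Submission
  imports Defs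
begin

text \<open>
  The Leibnitz numbers satisfy the reversed Pascal rule
  \<open>l(n, k) + l(n, k + 1) = l(n - 1, k)\<close>. Summing it over \<open>k\<close> counts every entry of row \<open>n\<close>
  twice except the two border entries \<open>1 / (n + 1)\<close>.
\<close>

lemma leibnitz_fact:
  assumes "k \<le> n"
  shows "leibnitz n k = fact k * fact (n - k) / fact (Suc n)"
  using assms by (simp add: leibnitz_def binomial_fact add.commute)

text \<open>With \<open>j = n - k\<close>, both entries have denominator \<open>(n + 2)!\<close> and
  numerators sharing the factor \<open>k! * j!\<close>. The cofactors \<open>j + 1\<close> and
  \<open>k + 1\<close> add up to \<open>n + 2\<close>, which cancels against the factorial.\<close>

lemma leibnitz_Suc_add:
  assumes "k \<le> n"
  shows "leibnitz (Suc n) k + leibnitz (Suc n) (Suc k) = leibnitz n k"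
proof -
  obtain j where n: "n = k + j"
    using assms le_Suc_ex by blast
  have "leibnitz (Suc n) k + leibnitz (Suc n) (Suc k)
      = (fact k * fact (Suc j) + fact (Suc k) * fact j) / fact (Suc (Suc n))"
    by (simp add: leibnitz_fact n Suc_diff_le add_divide_distrib del: fact_Suc)
  also have "fact k * fact (Suc j) + fact (Suc k) * fact j
      = (real (Suc (Suc n)) * (fact k * fact j) :: real)"
    by (simp add: n algebra_simps)
  also have "\<dots> / fact (Suc (Suc n)) = fact k * fact j / fact (Suc n)"
    by (simp only: fact_Suc[of "Suc n"] of_nat_mult mult_divide_mult_cancel_left_if) simp
  also have "\<dots> = leibnitz n k"
    by (simp add: leibnitz_fact n del: fact_Suc)
  finally show ?thesis .
qed

lemma sum_leibnitz_Suc: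
  "2 * (\<Sum>k = 0..Suc n. leibnitz (Suc n) k) = (\<Sum>k = 0..n. leibnitz n k) + 2 / (real n + 2)"
proof -
  have "(\<Sum>k = 0..n. leibnitz n k)
      = (\<Sum>k = 0..n. leibnitz (Suc n) k) + (\<Sum>k = 0..n. leibnitz (Suc n) (Suc k))"
    by (simp add: leibnitz_Suc_add flip: sum.distrib)
  \<comment> \<open>The same row is split off once at its last and once at its first entry, so that
    adding the two splittings brings in both sums of the previous equation.\<close>
  moreover have "(\<Sum>k = 0..Suc n. leibnitz (Suc n) k)
      = (\<Sum>k = 0..n. leibnitz (Suc n) k) + 1 / (real n + 2)"
    by (simp add: leibnitz_def add.commute)
  moreover have "(\<Sum>k = 0..Suc n. leibnitz (Suc n) k)
      = 1 / (real n + 2) + (\<Sum>k = 0..n. leibnitz (Suc n) (Suc k))"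
    by (subst sum.atLeast0_atMost_Suc_shift) (simp add: leibnitz_def add.commute)
  ultimately show ?thesis
    by simp
qed

theorem theorem2p9:
  fixes n :: nat
  assumes "n \<ge> 1"
  shows "(\<Sum>k = 0..n. leibnitz n k) - 1 / 2 * (\<Sum>k = 0..n - 1. leibnitz (n - 1) k)
           = (-1) ^ n / fact n * daehee n"
proof -
  obtain m where n: "n = Suc m"
    using assms not0_implies_Suc by fastforce
  \<comment> \<open>The two signs merge into \<open>((-1) * (-1)) ^ n = 1\<close>, leaving one
    border entry of row \<open>n\<close>.\<close>
  have "(-1) ^ n / fact n * daehee n = 1 / (real m + 2)"
    by (simp add: daehee_explicit n del: fact_Suc flip: power_mult_distrib)
  with sum_leibnitz_Suc[of m] show ?thesis
    unfolding n diff_Suc_1 by simp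
qed

end
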